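(* Let $d,N\ge1$ and $X_1,\dots,X_N\in\mathbb{R}^d$. Suppose that $\rho_0\in\mathcal{P}(\mathbb{R}^d)$ satisfies $\mathrm{supp}(\rho_0)=\mathbb{R}^d$. There exists $\gamma_0>0$, determined by the samples $X_1,\dots,X_N$, such that the following holds: if $0<\gamma\le\gamma_0$, $\{\rho_n\}_{n\ge0}$ is the Fisher-Rao gradient descent with step size $\gamma$ started from $\rho_0$, i.e. $$\frac{\mathrm{d}\rho_{n+1}}{\mathrm{d}\rho_n}=1-\gamma\,[1+\delta\ell_N(\rho_n)],\qquad n=0,1,\dots,$$ and $\rho_n$ converges weakly to some $\widehat\rho\in\mathcal{P}(\mathbb{R}^d)$ as $n\to\infty$, then $\widehat\rho$ is an NPMLE, i.e. a minimizer of $\ell_N$ over $\mathcal{P}(\mathbb{R}^d)$.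
   Context: $\mathcal{P}(\mathbb{R}^d)$ is the set of Borel probability measures on $\mathbb{R}^d$; $\mathrm{supp}(\rho)$ is the smallest closed set of full $\rho$-measure; weak convergence is convergence of integrals of bounded continuous functions. $\phi(x)=(2\pi)^{-d/2}\exp(-\|x\|_2^2/2)$, $(\rho*\phi)(x)=\int\phi(x-y)\,\rho(\mathrm{d}y)$, $\ell_N(\rho)=-\frac1N\sum_{i=1}^N\log[(\rho*\phi)(X_i)]$, and $\delta\ell_N(\rho)(x)=-\frac1N\sum_{i=1}^N\frac{\phi(x-X_i)}{(\rho*\phi)(X_i)}$. *)

theory Defs
  imports "HOL-Probability.Probability"
begin

definition borel_prob :: "(real ^ 'd) measure set" where
  "borel_prob = {\<rho>. prob_space \<rho> \<and> sets \<rho> = sets borel}"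

definition msupp :: "(real ^ 'd) measure \<Rightarrow> (real ^ 'd) set" where
  "msupp \<rho> = \<Inter> {C. closed C \<and> emeasure \<rho> C = emeasure \<rho> (space \<rho>)}"

text \<open>The intersection is itself a closed set of full measure, hence the smallest one.\<close>

lemma msupp_smallest:
  assumes "\<rho> \<in> borel_prob"
  shows "closed (msupp \<rho>)"
    and "measure \<rho> (msupp \<rho>) = 1"
    and "\<And>C. closed C \<Longrightarrow> measure \<rho> C = 1 \<Longrightarrow> msupp \<rho> \<subseteq> C"
proof -
  interpret prob_space \<rho> using assms by (simp add: borel_prob_def)
  have sets: "sets \<rho> = sets borel" using assms by (simp add: borel_prob_def)
  have space: "space \<rho> = UNIV" using sets_eq_imp_space_eq[OF sets] by simp
  have full: "emeasure \<rho> C = emeasure \<rho> (space \<rho>) \<longleftrightarrow> measure \<rho> C = 1" for C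
    by (simp add: emeasure_eq_measure prob_space)
  show cl: "closed (msupp \<rho>)" unfolding msupp_def by (rule closed_Inter) auto
  show "\<And>C. closed C \<Longrightarrow> measure \<rho> C = 1 \<Longrightarrow> msupp \<rho> \<subseteq> C"
    unfolding msupp_def full by auto
  define F where "F = {C. closed C \<and> measure \<rho> C = 1}"
  obtain G where G: "G \<subseteq> uminus ` F" "countable G" "\<Union>G = \<Union>(uminus ` F)"
    by (rule Lindelof[of "uminus ` F"]) (auto simp: F_def open_Compl)
  have null: "U \<in> null_sets \<rho>" if "U \<in> G" for U
  proof -
    have "U \<in> uminus ` F" using G(1) that by (rule subsetD)
    then obtain C where C: "C \<in> F" "U = - C" by (rule imageE)
    have "C \<in> events" using C(1) unfolding F_def sets by simp
    then have "measure \<rho> (space \<rho> - C) = 0" using C(1) prob_compl unfolding F_def by simp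
    moreover have U: "U = space \<rho> - C" unfolding space C(2) by (rule Compl_eq_Diff_UNIV)
    moreover have "U \<in> events" unfolding U using \<open>C \<in> events\<close> by (rule sets.compl_sets)
    ultimately show ?thesis by (simp add: null_sets_def emeasure_eq_measure)
  qed
  have N: "\<Union>G \<in> null_sets \<rho>"
    using null_sets_UN'[of G "\<lambda>U. U" \<rho>] null G(2) by simp
  have "msupp \<rho> = \<Inter>F" unfolding msupp_def full F_def ..
  also have "\<dots> = - \<Union>G" unfolding G(3) by blast
  also have "\<dots> = space \<rho> - \<Union>G" unfolding space by (rule Compl_eq_Diff_UNIV)
  finally have eq: "msupp \<rho> = space \<rho> - \<Union>G" .
  have "measure \<rho> (\<Union>G) = 0" using N by (simp add: null_sets_def measure_def)
  then show "measure \<rho> (msupp \<rho>) = 1"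
    unfolding eq using prob_compl[of "\<Union>G"] null_setsD2[OF N] by simp
qed

text \<open>The library's \<open>weak_conv_m\<close> is restricted to measures on the real line.\<close>

definition weakly_converges ::
    "(nat \<Rightarrow> (real ^ 'd) measure) \<Rightarrow> (real ^ 'd) measure \<Rightarrow> bool" where
  "weakly_converges \<rho> \<rho>' \<longleftrightarrow>
     (\<forall>f :: real ^ 'd \<Rightarrow> real. continuous_on UNIV f \<longrightarrow> bounded (range f) \<longrightarrow>
        (\<lambda>n. \<integral>x. f x \<partial>\<rho> n) \<longlonglongrightarrow> (\<integral>x. f x \<partial>\<rho>'))"

definition gauss :: "real ^ 'd \<Rightarrow> real" where
  "gauss x = (2 * pi) powr (- real CARD('d) / 2) * exp (- (norm x)\<^sup>2 / 2)"

definition gauss_conv :: "(real ^ 'd) measure \<Rightarrow> real ^ 'd \<Rightarrow> real" where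
  "gauss_conv \<rho> x = (\<integral>y. gauss (x - y) \<partial>\<rho>)"

definition nll :: "nat \<Rightarrow> (nat \<Rightarrow> real ^ 'd) \<Rightarrow> (real ^ 'd) measure \<Rightarrow> real" where
  "nll N X \<rho> = - (1 / real N) * (\<Sum>i = 1..N. ln (gauss_conv \<rho> (X i)))"

definition nll_var ::
    "nat \<Rightarrow> (nat \<Rightarrow> real ^ 'd) \<Rightarrow> (real ^ 'd) measure \<Rightarrow> real ^ 'd \<Rightarrow> real" where
  "nll_var N X \<rho> x =
     - (1 / real N) * (\<Sum>i = 1..N. gauss (x - X i) / gauss_conv \<rho> (X i))"

definition is_npmle :: "nat \<Rightarrow> (nat \<Rightarrow> real ^ 'd) \<Rightarrow> (real ^ 'd) measure \<Rightarrow> bool" where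
  "is_npmle N X \<rho> \<longleftrightarrow> \<rho> \<in> borel_prob \<and> (\<forall>\<mu>\<in>borel_prob. nll N X \<rho> \<le> nll N X \<mu>)"

text \<open>
  \<open>has_RN_density \<mu> \<nu> g\<close> says that \<open>d\<nu>/d\<mu> = g\<close>. Nonnegativity is required
  explicitly because \<open>ennreal\<close> would otherwise truncate negative values of \<open>g\<close> to \<open>0\<close>.
\<close>

definition has_RN_density :: "'a measure \<Rightarrow> 'a measure \<Rightarrow> ('a \<Rightarrow> real) \<Rightarrow> bool" where
  "has_RN_density \<mu> \<nu> g \<longleftrightarrow>
     g \<in> borel_measurable \<mu> \<and> (AE x in \<mu>. 0 \<le> g x) \<and> \<nu> = density \<mu> (\<lambda>x. ennreal (g x))"

text \<open>
  If \<open>\<rho>\<^sub>0\<close> is a probability measure then so is every \<open>\<rho> n\<close>: each step preserves total mass, since \<open>nll_var N X (\<rho> n)\<close> has \<open>\<rho> n\<close>-integral \<open>- 1\<close> when \<open>N \<ge> 1\<close>.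
\<close>

definition fisher_rao_gd ::
    "nat \<Rightarrow> (nat \<Rightarrow> real ^ 'd) \<Rightarrow> real \<Rightarrow> (real ^ 'd) measure \<Rightarrow>
      (nat \<Rightarrow> (real ^ 'd) measure) \<Rightarrow> bool" where
  "fisher_rao_gd N X \<gamma> \<rho>\<^sub>0 \<rho> \<longleftrightarrow>
     \<rho> 0 = \<rho>\<^sub>0 \<and>
     (\<forall>n. has_RN_density (\<rho> n) (\<rho> (Suc n)) (\<lambda>x. 1 - \<gamma> * (1 + nll_var N X (\<rho> n) x)))"

end

theory Submission
  imports Defs
begin

text \<open>
  Put \<open>g \<mu> = - nll_var N X \<mu>\<close>, so that one step multiplies \<open>\<rho> n\<close> by \<open>1 - \<gamma> + \<gamma> * g (\<rho> n)\<close>,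
  which is positive as soon as \<open>\<gamma> \<le> 1\<close>. Hence every \<open>\<rho> n\<close> charges every nonempty open set.
  If the limit \<open>\<rho>'\<close> is not a minimizer, then, by \<open>ln t \<le> t - 1\<close>, \<open>g \<rho>'\<close> exceeds some \<open>K\<^sup>2 > 1\<close> on
  a nonempty open set \<open>B\<close>. Weak convergence gives \<open>gauss_conv (\<rho> n) (X i) \<le> K * gauss_conv \<rho>' (X i)\<close>
  for large \<open>n\<close>, so \<open>g (\<rho> n) \<ge> K\<close> on \<open>B\<close> and the mass of \<open>B\<close> grows geometrically, which is absurd.
\<close>

section \<open>The Gaussian kernel and its convolutions\<close>

lemma gauss_pos: "gauss x > 0"
  by (simp add: gauss_def)

lemma gauss_le: "gauss (x :: real ^ 'd) \<le> gauss (0 :: real ^ 'd)"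
  by (simp add: gauss_def mult_right_le_one_le)

lemma gauss_minus_commute: "gauss (x - y) = gauss (y - x)"
  by (simp add: gauss_def norm_minus_commute)

lemma continuous_on_gauss [continuous_intros]:
  "continuous_on S f \<Longrightarrow> continuous_on S (\<lambda>x. gauss (f x))"
  unfolding gauss_def by (intro continuous_intros) auto

lemma borel_probD:
  assumes "\<rho> \<in> borel_prob"
  shows "prob_space \<rho>" "sets \<rho> = sets borel" "space \<rho> = UNIV"
  using assms sets_eq_imp_space_eq[of \<rho> borel] by (auto simp: borel_prob_def)

lemma continuous_borel_prob_measurable:
  assumes "\<rho> \<in> borel_prob" "continuous_on UNIV f"
  shows "f \<in> borel_measurable \<rho>"
  using borel_measurable_continuous_onI[OF assms(2)] borel_probD(2)[OF assms(1)]
  by (simp cong: measurable_cong_sets)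

lemma integrable_gauss:
  assumes "\<rho> \<in> borel_prob"
  shows "integrable \<rho> (\<lambda>y. gauss (a - y))"
proof -
  interpret prob_space \<rho> using borel_probD[OF assms] by simp
  show ?thesis
    by (rule integrable_const_bound[where B = "gauss (0 :: real ^ 'a)"])
       (auto intro!: continuous_borel_prob_measurable[OF assms] continuous_intros
          simp: gauss_le less_imp_le[OF gauss_pos])
qed

lemma gauss_conv_pos:
  assumes "\<rho> \<in> borel_prob"
  shows "gauss_conv \<rho> a > 0"
proof -
  interpret prob_space \<rho> using borel_probD[OF assms] by simp
  have "0 < (\<integral>y. gauss (a - y) \<partial>\<rho>)"
    using integral_less_AE_space[of "\<lambda>_. 0" "\<lambda>y. gauss (a - y)"]
    by (simp add: integrable_gauss[OF assms] gauss_pos emeasure_space_1)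
  then show ?thesis by (simp add: gauss_conv_def)
qed

section \<open>Integrals of the first variation and the optimality condition\<close>

lemma integrable_nll_var:
  assumes "\<mu> \<in> borel_prob"
  shows "integrable \<mu> (nll_var N X \<nu>)"
  unfolding nll_var_def[abs_def] gauss_minus_commute[of _ "X _"]
  using integrable_gauss[OF assms]
  by (intro integrable_mult_right integrable_sum integrable_divide) auto

text \<open>The integrating measure and the one in the weights are kept apart: they coincide for
  conservation of mass and differ in the comparison with a competitor.\<close>

lemma integral_nll_var:
  assumes "\<mu> \<in> borel_prob"
  shows "(\<integral>x. nll_var N X \<nu> x \<partial>\<mu>) =
    - (1 / real N) * (\<Sum>i = 1..N. gauss_conv \<mu> (X i) / gauss_conv \<nu> (X i))"
  unfolding nll_var_def gauss_minus_commute[of _ "X _"]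
  using integrable_gauss[OF assms]
  by (simp add: gauss_conv_def)

lemma continuous_nll_var: "continuous_on UNIV (nll_var N X \<nu>)"
  unfolding nll_var_def[abs_def] divide_inverse by (intro continuous_intros)

lemma nll_var_neg:
  assumes "\<nu> \<in> borel_prob" "N \<ge> 1"
  shows "nll_var N X \<nu> x < 0"
  using assms unfolding nll_var_def
  by (auto simp: mult_less_0_iff intro!: sum_pos divide_pos_pos gauss_pos gauss_conv_pos)

text \<open>By convexity the first-order condition suffices: integrating it against a competitor
  \<open>\<mu>\<close> bounds the sum of the ratios of convolutions by \<open>real N\<close>, and
  \<open>ln t \<le> t - 1\<close> turns this into a comparison of log-likelihoods.\<close>

lemma npmle_if_nll_var_ge:
  assumes "N \<ge> 1" and \<rho>: "\<rho> \<in> borel_prob" and ge: "\<And>x. nll_var N X \<rho> x \<ge> - 1"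
  shows "is_npmle N X \<rho>"
  unfolding is_npmle_def
proof (intro conjI ballI \<rho>)
  fix \<mu> :: "(real ^ 'a) measure" assume \<mu>: "\<mu> \<in> borel_prob"
  interpret prob_space \<mu> using borel_probD[OF \<mu>] by simp
  have "- 1 \<le> (\<integral>x. nll_var N X \<rho> x \<partial>\<mu>)"
    using integral_mono[of \<mu> "\<lambda>_. - 1" "nll_var N X \<rho>"] integrable_nll_var[OF \<mu>] ge
    by (simp add: prob_space)
  then have *: "(\<Sum>i = 1..N. gauss_conv \<mu> (X i) / gauss_conv \<rho> (X i)) \<le> real N"
    using \<open>N \<ge> 1\<close> by (simp add: integral_nll_var[OF \<mu>] field_simps)
  have "ln (gauss_conv \<mu> a) - ln (gauss_conv \<rho> a) \<le> gauss_conv \<mu> a / gauss_conv \<rho> a - 1" for a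
    using gauss_conv_pos[OF \<mu>, of a] gauss_conv_pos[OF \<rho>, of a]
      ln_le_minus_one[of "gauss_conv \<mu> a / gauss_conv \<rho> a"]
    by (simp add: ln_div)
  then have "(\<Sum>i = 1..N. ln (gauss_conv \<mu> (X i)) - ln (gauss_conv \<rho> (X i)))
      \<le> (\<Sum>i = 1..N. gauss_conv \<mu> (X i) / gauss_conv \<rho> (X i) - 1)"
    by (intro sum_mono)
  with * have "(\<Sum>i = 1..N. ln (gauss_conv \<mu> (X i))) \<le> (\<Sum>i = 1..N. ln (gauss_conv \<rho> (X i)))"
    by (simp add: sum_subtractf)
  then show "nll N X \<rho> \<le> nll N X \<mu>"
    unfolding nll_def using \<open>N \<ge> 1\<close> by (simp add: divide_right_mono)
qed

section \<open>Dependence of convolution and first variation on the measure\<close>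

lemma gauss_conv_weakly_converges:
  assumes "weakly_converges \<rho> \<rho>'"
  shows "(\<lambda>n. gauss_conv (\<rho> n) a) \<longlonglongrightarrow> gauss_conv \<rho>' a"
proof -
  have "bounded (range (\<lambda>y. gauss (a - y)))"
    by (rule boundedI[of _ "gauss (0 :: real ^ 'a)"])
       (auto simp: gauss_le less_imp_le[OF gauss_pos])
  moreover have "continuous_on UNIV (\<lambda>y. gauss (a - y))"
    by (intro continuous_intros)
  ultimately show ?thesis
    using assms unfolding weakly_converges_def gauss_conv_def by blast
qed

text \<open>The measure enters \<open>nll_var\<close> only through the positive denominators, so
  enlarging each by a factor of at most \<open>K\<close> shrinks \<open>- nll_var\<close> by at most
  that factor.\<close>

lemma nll_var_le_scaled:
  assumes \<nu>: "\<nu> \<in> borel_prob" and \<nu>': "\<nu>' \<in> borel_prob" and "K > 0"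
    and le: "\<And>i. i \<in> {1..N} \<Longrightarrow> gauss_conv \<nu> (X i) \<le> K * gauss_conv \<nu>' (X i)"
  shows "K * nll_var N X \<nu> x \<le> nll_var N X \<nu>' x"
proof -
  have "gauss (x - X i) / gauss_conv \<nu>' (X i) \<le> K * (gauss (x - X i) / gauss_conv \<nu> (X i))"
    if "i \<in> {1..N}" for i
    using mult_left_mono[OF le[OF that], of "gauss (x - X i)"] gauss_pos[of "x - X i"]
      gauss_conv_pos[OF \<nu>, of "X i"] gauss_conv_pos[OF \<nu>', of "X i"]
    by (simp add: field_simps)
  then have "(\<Sum>i = 1..N. gauss (x - X i) / gauss_conv \<nu>' (X i))
      \<le> K * (\<Sum>i = 1..N. gauss (x - X i) / gauss_conv \<nu> (X i))"
    unfolding sum_distrib_left by (rule sum_mono)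
  then show ?thesis
    unfolding nll_var_def by (simp add: divide_right_mono)
qed

section \<open>One gradient step\<close>

lemma step_density_pos:
  assumes "N \<ge> 1" "\<nu> \<in> borel_prob" "0 < \<gamma>" "\<gamma> \<le> 1"
  shows "0 < 1 - \<gamma> * (1 + nll_var N X \<nu> x)"
  \<comment> \<open>The step factor is the nonnegative \<open>1 - \<gamma>\<close> plus the strictly
    positive \<open>- \<gamma> * nll_var N X \<nu> x\<close>, so the boundary case
    \<open>\<gamma> = 1\<close> is covered.\<close>
  using mult_pos_neg[OF assms(3) nll_var_neg[OF assms(2,1), of X x]] assms(4)
  by (simp add: algebra_simps)

lemma step_borel_prob:
  assumes N: "N \<ge> 1" and \<nu>: "\<nu> \<in> borel_prob" and \<gamma>: "0 < \<gamma>" "\<gamma> \<le> 1"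
    and step: "has_RN_density \<nu> \<nu>' (\<lambda>x. 1 - \<gamma> * (1 + nll_var N X \<nu> x))"
  shows "\<nu>' \<in> borel_prob"
proof -
  define r where "r = (\<lambda>x. 1 - \<gamma> * (1 + nll_var N X \<nu> x))"
  interpret prob_space \<nu> using borel_probD[OF \<nu>] by simp
  have r: "r \<in> borel_measurable \<nu>" and \<nu>': "\<nu>' = density \<nu> (\<lambda>x. ennreal (r x))"
    using step unfolding has_RN_density_def r_def by auto
  \<comment> \<open>With both measures equal every ratio is 1; this is what makes the density
    integrate to 1.\<close>
  have "(\<Sum>i = 1..N. gauss_conv \<nu> (X i) / gauss_conv \<nu> (X i)) = real N"
    using gauss_conv_pos[OF \<nu>] by (simp add: less_imp_neq[symmetric])
  then have "(\<integral>x. nll_var N X \<nu> x \<partial>\<nu>) = - 1"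
    using N by (simp add: integral_nll_var[OF \<nu>])
  then have int: "integrable \<nu> r" "(\<integral>x. r x \<partial>\<nu>) = 1"
    unfolding r_def using integrable_nll_var[OF \<nu>, of N X \<nu>] by (simp_all add: prob_space)
  have "emeasure \<nu>' (space \<nu>') = (\<integral>\<^sup>+x. ennreal (r x) \<partial>\<nu>)"
    unfolding \<nu>' using r by (simp add: emeasure_density cong: nn_integral_cong)
  also have "\<dots> = 1"
    using int step_density_pos[OF N \<nu> \<gamma>]
    by (subst nn_integral_eq_integral) (auto simp: r_def less_imp_le)
  finally have "prob_space \<nu>'" by (rule prob_spaceI)
  then show ?thesis using borel_probD(2)[OF \<nu>] by (simp add: borel_prob_def \<nu>')
qed

text \<open>A strictly positive density preserves the null sets in both directions; read
  contrapositively, a set charged before the step is still charged after it.\<close>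

lemma step_null_set:
  assumes N: "N \<ge> 1" and \<nu>: "\<nu> \<in> borel_prob" and \<gamma>: "0 < \<gamma>" "\<gamma> \<le> 1"
    and step: "has_RN_density \<nu> \<nu>' (\<lambda>x. 1 - \<gamma> * (1 + nll_var N X \<nu> x))"
    and null: "B \<in> null_sets \<nu>'"
  shows "B \<in> null_sets \<nu>"
proof -
  have B: "B \<in> sets \<nu>" "AE x in \<nu>. x \<in> B \<longrightarrow> ennreal (1 - \<gamma> * (1 + nll_var N X \<nu> x)) = 0"
    using null step null_sets_density_iff[of "\<lambda>x. ennreal (1 - \<gamma> * (1 + nll_var N X \<nu> x))" \<nu> B]
    unfolding has_RN_density_def by (auto simp del: ennreal_eq_zero_iff)
  have "AE x in \<nu>. x \<notin> B"
    using B(2)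
  proof eventually_elim
    case (elim x)
    then show ?case
      using step_density_pos[OF N \<nu> \<gamma>, of X x] by (auto simp: ennreal_eq_0_iff)
  qed
  then show ?thesis using B(1) by (simp add: AE_iff_null_sets)
qed

text \<open>Serves to turn a pointwise lower bound on the step factor into growth of mass.\<close>

lemma emeasure_density_ge:
  assumes "has_RN_density \<mu> \<nu> g" "B \<in> sets \<mu>" "\<And>x. x \<in> B \<Longrightarrow> q \<le> g x"
  shows "ennreal q * emeasure \<mu> B \<le> emeasure \<nu> B"
proof -
  have g: "g \<in> borel_measurable \<mu>" and \<nu>: "\<nu> = density \<mu> (\<lambda>x. ennreal (g x))"
    using assms(1) by (auto simp: has_RN_density_def)
  have "ennreal q * emeasure \<mu> B = (\<integral>\<^sup>+x. ennreal q * indicator B x \<partial>\<mu>)"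
    using assms(2) by (simp add: nn_integral_cmult_indicator)
  also have "\<dots> \<le> (\<integral>\<^sup>+x. ennreal (g x) * indicator B x \<partial>\<mu>)"
    by (intro nn_integral_mono) (auto simp: assms(3) ennreal_leI split: split_indicator)
  also have "\<dots> = emeasure \<nu> B"
    unfolding \<nu> using g assms(2) by (simp add: emeasure_density)
  finally show ?thesis .
qed

text \<open>Otherwise the complement would be a closed set of full measure, hence contain the
  support.\<close>

lemma open_not_null_if_full_support:
  assumes \<rho>: "\<rho> \<in> borel_prob" and supp: "msupp \<rho> = UNIV" and U: "open U" "U \<noteq> {}"
  shows "U \<notin> null_sets \<rho>"
proof
  assume "U \<in> null_sets \<rho>"
  interpret prob_space \<rho> using borel_probD[OF \<rho>] by simp
  have "measure \<rho> (space \<rho> - U) = 1"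
    using prob_compl[of U] \<open>U \<in> null_sets \<rho>\<close> by (auto simp: null_sets_def measure_def)
  then have "msupp \<rho> \<subseteq> - U"
    using msupp_smallest(3)[OF \<rho>, of "- U"] U(1) borel_probD(3)[OF \<rho>]
    by (simp add: closed_Compl flip: Compl_eq_Diff_UNIV)
  with supp U(2) show False by auto
qed

section \<open>Geometric growth of mass against weak convergence\<close>

theorem theorem4:
  fixes N :: nat and X :: "nat \<Rightarrow> real ^ 'd"
  assumes "N \<ge> 1"
  shows "\<exists>\<gamma>\<^sub>0 > 0. \<forall>\<rho>\<^sub>0 \<gamma> \<rho> \<rho>'.
           \<rho>\<^sub>0 \<in> borel_prob \<longrightarrow> msupp \<rho>\<^sub>0 = UNIV \<longrightarrow>
           0 < \<gamma> \<longrightarrow> \<gamma> \<le> \<gamma>\<^sub>0 \<longrightarrow>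
           fisher_rao_gd N X \<gamma> \<rho>\<^sub>0 \<rho> \<longrightarrow>
           \<rho>' \<in> borel_prob \<longrightarrow> weakly_converges \<rho> \<rho>' \<longrightarrow>
           is_npmle N X \<rho>'"
proof (intro exI[of _ 1] conjI allI impI)
  \<comment> \<open>The witness 1 serves every choice of samples: it is the bound under which the
    step factor stays positive.\<close>
  fix \<rho>\<^sub>0 \<rho>' :: "(real ^ 'd) measure" and \<gamma> :: real and \<rho> :: "nat \<Rightarrow> (real ^ 'd) measure"
  assume \<rho>\<^sub>0: "\<rho>\<^sub>0 \<in> borel_prob" "msupp \<rho>\<^sub>0 = UNIV" and \<gamma>: "0 < \<gamma>" "\<gamma> \<le> 1"
    and gd: "fisher_rao_gd N X \<gamma> \<rho>\<^sub>0 \<rho>"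
    and \<rho>': "\<rho>' \<in> borel_prob" and conv: "weakly_converges \<rho> \<rho>'"
  have step: "has_RN_density (\<rho> n) (\<rho> (Suc n)) (\<lambda>x. 1 - \<gamma> * (1 + nll_var N X (\<rho> n) x))" for n
    using gd by (simp add: fisher_rao_gd_def)
  have prob: "\<rho> n \<in> borel_prob" for n
  proof (induction n)
    case 0
    then show ?case using gd \<rho>\<^sub>0 by (simp add: fisher_rao_gd_def)
  next
    case (Suc n)
    then show ?case using step_borel_prob[OF assms _ \<gamma> step] by blast
  qed
  have charged: "U \<notin> null_sets (\<rho> n)" if "open U" "U \<noteq> {}" for U n
  proof (induction n)
    case 0
    then show ?case
      using gd open_not_null_if_full_support[OF \<rho>\<^sub>0 that] by (simp add: fisher_rao_gd_def)
  next
    case (Suc n)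
    then show ?case using step_null_set[OF assms prob \<gamma> step] by blast
  qed
  show "is_npmle N X \<rho>'"
  proof (rule npmle_if_nll_var_ge[OF assms \<rho>'], rule ccontr)
    fix x\<^sub>0 assume "\<not> - 1 \<le> nll_var N X \<rho>' x\<^sub>0"
    \<comment> \<open>The gap below \<open>- nll_var N X \<rho>' x\<^sub>0\<close> puts
      \<open>x\<^sub>0\<close> into the open set \<open>B\<close>; the gap above 1 yields
      \<open>K > 1\<close>.\<close>
    then obtain H where H: "1 < H" "H < - nll_var N X \<rho>' x\<^sub>0"
      using dense[of 1 "- nll_var N X \<rho>' x\<^sub>0"] by auto
    \<comment> \<open>The square root splits the excess \<open>H\<close>: one factor
      \<open>K\<close> absorbs the error of weak convergence, the other survives as growth.\<close>
    define K where "K = sqrt H"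
    have K: "1 < K" "K * K = H" using H(1) by (simp_all add: K_def)
    define B where "B = {x. nll_var N X \<rho>' x < - H}"
    have B: "open B" "B \<noteq> {}"
      unfolding B_def using H(2)
      by (auto intro!: open_Collect_less continuous_nll_var continuous_intros exI[of _ x\<^sub>0])
    \<comment> \<open>As \<open>K > 1\<close>, each positive limit lies strictly below its bound;
      the samples being finitely many, one threshold \<open>m\<close> serves them all.\<close>
    have "\<forall>\<^sub>F n in sequentially. \<forall>i\<in>{1..N}. gauss_conv (\<rho> n) (X i) < K * gauss_conv \<rho>' (X i)"
      using K(1) gauss_conv_pos[OF \<rho>']
      by (intro eventually_ball_finite ballI order_tendstoD(2)[OF gauss_conv_weakly_converges[OF conv]])
         simp_all
    then obtain m where m:
        "\<And>n i. n \<ge> m \<Longrightarrow> i \<in> {1..N} \<Longrightarrow> gauss_conv (\<rho> n) (X i) < K * gauss_conv \<rho>' (X i)"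
      unfolding eventually_sequentially by blast
    \<comment> \<open>The value of the step factor when the first variation equals
      \<open>- K\<close>.\<close>
    define q where "q = 1 + \<gamma> * (K - 1)"
    have q: "q > 1" using \<gamma> K by (simp add: q_def)
    have growth: "q * measure (\<rho> n) B \<le> measure (\<rho> (Suc n)) B" if "n \<ge> m" for n
    proof -
      interpret n: prob_space "\<rho> n" using borel_probD[OF prob] by simp
      interpret Sn: prob_space "\<rho> (Suc n)" using borel_probD[OF prob] by simp
      have "q \<le> 1 - \<gamma> * (1 + nll_var N X (\<rho> n) x)" if "x \<in> B" for x
      proof -
        have "K * nll_var N X (\<rho> n) x \<le> nll_var N X \<rho>' x"
          using K(1) m[OF \<open>n \<ge> m\<close>] by (intro nll_var_le_scaled prob \<rho>') (auto simp: less_imp_le)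
        also have "\<dots> \<le> K * (- K)" using that K(2) by (simp add: B_def)
        finally have "nll_var N X (\<rho> n) x \<le> - K"
          by (rule mult_left_le_imp_le) (use K(1) in simp)
        then have "\<gamma> * nll_var N X (\<rho> n) x \<le> \<gamma> * (- K)"
          using \<gamma>(1) by (intro mult_left_mono) simp_all
        then show ?thesis by (simp add: q_def algebra_simps)
      qed
      then have "ennreal q * emeasure (\<rho> n) B \<le> emeasure (\<rho> (Suc n)) B"
        using B(1) borel_probD(2)[OF prob] by (intro emeasure_density_ge[OF step]) auto
      then show ?thesis
        using q by (simp add: n.emeasure_eq_measure Sn.emeasure_eq_measure flip: ennreal_mult)
    qed
    have power: "q ^ k * measure (\<rho> m) B \<le> measure (\<rho> (m + k)) B" for k
    proof (induction k)
      case (Suc k)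
      have "q ^ Suc k * measure (\<rho> m) B \<le> q * measure (\<rho> (m + k)) B"
        using mult_left_mono[OF Suc, of q] q by (simp add: mult.assoc)
      also have "\<dots> \<le> measure (\<rho> (m + Suc k)) B" using growth[of "m + k"] by simp
      finally show ?case .
    qed simp
    interpret m: prob_space "\<rho> m" using borel_probD[OF prob] by simp
    \<comment> \<open>Full support of \<open>\<rho>\<^sub>0\<close> enters here: geometric growth
      needs positive mass at time \<open>m\<close>.\<close>
    have "measure (\<rho> m) B > 0"
      using charged[OF B, of m] B(1) borel_probD(2)[OF prob, of m]
      by (auto simp: null_sets_def m.emeasure_eq_measure zero_less_measure_iff)
    moreover obtain k where "1 / measure (\<rho> m) B < q ^ k"
      using real_arch_pow[OF q] by blast
    ultimately have "1 < q ^ k * measure (\<rho> m) B" by (simp add: field_simps)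
    then show False
      using power[of k] prob_space.prob_le_1[OF borel_probD(1)[OF prob], of "m + k" B] by linarith
  qed
qed simp

end
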